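(* For every subcubic bipartite graph $G$, $\chi'_{\mathrm{inj}}(G)\leq 6$.
   Context: All graphs are finite and simple. A graph is subcubic if its maximum degree is at most $3$. Three edges $e_1,e_2,e_3$ of a graph are consecutive if they form (in this order) a path of length three or a cycle of length three. An injective edge-coloring of $G$ with $k$ colors is a map $c:E(G)\to\{1,\dots,k\}$ (not necessarily a proper edge-coloring) such that $c(e_1)\neq c(e_3)$ whenever $e_1,e_2,e_3$ are consecutive edges in $G$. The injective chromatic index $\chi'_{\mathrm{inj}}(G)$ is the minimum $k$ such that $G$ has an injective edge-coloring with $k$ colors. *)

theory Defs
  imports Main
begin

text \<open>
  A finite simple graph is given by a vertex set \<open>V\<close> and a set \<open>E\<close> of edges, each edge
  being an (unordered) two-element subset of \<open>V\<close>.
\<close>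

definition finite_simple_graph :: "'a set \<Rightarrow> 'a set set \<Rightarrow> bool" where
  "finite_simple_graph V E \<longleftrightarrow> finite V \<and> (\<forall>e\<in>E. e \<subseteq> V \<and> card e = 2)"

definition degree :: "'a set set \<Rightarrow> 'a \<Rightarrow> nat" where
  "degree E v = card {e \<in> E. v \<in> e}"

text \<open>The element \<open>0\<close> is inserted only so that the graph without vertices has maximum degree \<open>0\<close>.\<close>

definition max_degree :: "'a set \<Rightarrow> 'a set set \<Rightarrow> nat" where
  "max_degree V E = Max (insert 0 (degree E ` V))"

definition subcubic :: "'a set \<Rightarrow> 'a set set \<Rightarrow> bool" where
  "subcubic V E \<longleftrightarrow> max_degree V E \<le> 3"

definition bipartite :: "'a set \<Rightarrow> 'a set set \<Rightarrow> bool" where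
  "bipartite V E \<longleftrightarrow>
     (\<exists>X Y. X \<union> Y = V \<and> X \<inter> Y = {} \<and> (\<forall>e\<in>E. \<exists>x\<in>X. \<exists>y\<in>Y. e = {x, y}))"

text \<open>The first disjunct is a path with three edges, the second one a triangle.\<close>

definition consecutive :: "'a set set \<Rightarrow> 'a set \<Rightarrow> 'a set \<Rightarrow> 'a set \<Rightarrow> bool" where
  "consecutive E e1 e2 e3 \<longleftrightarrow> e1 \<in> E \<and> e2 \<in> E \<and> e3 \<in> E \<and>
     ((\<exists>w x y z. distinct [w, x, y, z] \<and> e1 = {w, x} \<and> e2 = {x, y} \<and> e3 = {y, z}) \<or>
      (\<exists>x y z. distinct [x, y, z] \<and> e1 = {x, y} \<and> e2 = {y, z} \<and> e3 = {z, x}))"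

definition injective_edge_coloring :: "'a set set \<Rightarrow> nat \<Rightarrow> ('a set \<Rightarrow> nat) \<Rightarrow> bool" where
  "injective_edge_coloring E k c \<longleftrightarrow>
     c ` E \<subseteq> {1..k} \<and> (\<forall>e1 e2 e3. consecutive E e1 e2 e3 \<longrightarrow> c e1 \<noteq> c e3)"

definition injective_chromatic_index :: "'a set set \<Rightarrow> nat" where
  "injective_chromatic_index E = (LEAST k. \<exists>c. injective_edge_coloring E k c)"

lemma subcubic_iff:
  assumes "finite V"
  shows "subcubic V E \<longleftrightarrow> (\<forall>v\<in>V. degree E v \<le> 3)"
  using assms by (simp add: subcubic_def max_degree_def)

text \<open>
  The minimum is over a nonempty set of numbers of colors, so the index of a finite simple
  graph is attained.
\<close>

lemma injective_edge_coloring_exists: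
  assumes "finite_simple_graph V E"
  shows "\<exists>k c. injective_edge_coloring E k c"
proof -
  have "finite E"
    using assms finite_subset[of E "Pow V"] by (auto simp: finite_simple_graph_def)
  then obtain f :: "'a set \<Rightarrow> nat" where f: "bij_betw f E {1..card E}"
    using finite_same_card_bij[of E "{1..card E}"] by auto
  have "f e1 \<noteq> f e3" if "consecutive E e1 e2 e3" for e1 e2 e3
  proof -
    have "e1 \<noteq> e3" "e1 \<in> E" "e3 \<in> E"
      using that by (auto simp: consecutive_def doubleton_eq_iff)
    then show ?thesis
      using f by (auto simp: bij_betw_def dest: inj_onD)
  qed
  then have "injective_edge_coloring E (card E) f"
    using f by (auto simp: injective_edge_coloring_def bij_betw_def)
  then show ?thesis by blast
qed

lemma injective_chromatic_index_attained:
  assumes "finite_simple_graph V E"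
  shows "\<exists>c. injective_edge_coloring E (injective_chromatic_index E) c"
  unfolding injective_chromatic_index_def
  by (rule LeastI_ex) (rule injective_edge_coloring_exists[OF assms])

end

theory Submission
  imports Defs
begin

text \<open>
  Let \<open>X\<close>, \<open>Y\<close> be the two sides, and call two vertices of \<open>X\<close> linked if they have a common
  neighbour; every vertex is linked to at most six others. A coloring of \<open>X\<close> in which linked
  vertices differ gives an injective edge-coloring: color each edge like its end in \<open>X\<close>. Six colors
  suffice greedily unless some nonempty \<open>U \<subseteq> X\<close> has all its vertices linked to six vertices of
  \<open>U\<close>. For a minimal such \<open>U\<close>, no vertex of \<open>U\<close> is linked to a vertex outside \<open>U\<close>, all vertices of
  \<open>U\<close> have three neighbours, these have three neighbours in \<open>U\<close>, and there are no 4-cycles.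
  Fix a neighbour \<open>b\<close> of \<open>U\<close> and let \<open>L\<close> be its neighbourhood. By minimality, \<open>U - L\<close> can be colored
  greedily, which leaves each \<open>p \<in> L\<close> a list of at least two colors. An edge at \<open>p \<in> L\<close> conflicts
  with an edge at another \<open>q \<in> L\<close> only if exactly one of the two contains \<open>b\<close>, so it
  suffices to take from the list of each \<open>p\<close> a color \<open>x p\<close> for the edge \<open>pb\<close> and a color \<open>y p\<close> for the
  other edges at \<open>p\<close> such that \<open>x p \<noteq> y q\<close> for \<open>p \<noteq> q\<close>. If the three lists are equal, let \<open>x\<close>
  and \<open>y\<close> be two different constants; otherwise the lists have distinct representatives, and \<open>x = y\<close>
  works.
\<close>

section \<open>Greedy coloring and choices from three short lists\<close>

lemma degenerate_coloring:
  fixes R :: "'a \<Rightarrow> 'a \<Rightarrow> bool"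
  assumes "finite S" and sym: "\<And>a b. R a b \<Longrightarrow> R b a" and irrefl: "\<And>a. \<not> R a a"
    and "\<And>T. T \<subseteq> S \<Longrightarrow> T \<noteq> {} \<Longrightarrow> \<exists>a\<in>T. card {b \<in> T. R a b} < k"
  shows "\<exists>f. (\<forall>a\<in>S. f a < k) \<and> (\<forall>a\<in>S. \<forall>b\<in>S. R a b \<longrightarrow> f a \<noteq> (f b :: nat))"
  using assms(1,4)
proof (induction S rule: finite_psubset_induct)
  case (psubset S)
  show ?case
  proof (cases "S = {}")
    case False
    \<comment> \<open>An element related to fewer than \<open>k\<close> elements of all of
      \<open>S\<close> is colored last, when fewer than \<open>k\<close> colors are blocked.\<close>
    then obtain a where a: "a \<in> S" "card {b \<in> S. R a b} < k"
      using psubset.prems by blast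
    have "\<exists>f. (\<forall>a\<in>S-{a}. f a < k) \<and> (\<forall>p\<in>S-{a}. \<forall>b\<in>S-{a}. R p b \<longrightarrow> f p \<noteq> (f b :: nat))"
    proof (rule psubset.IH)
      show "S - {a} \<subset> S" using a by auto
      show "\<exists>a\<in>T. card {b \<in> T. R a b} < k" if "T \<subseteq> S - {a}" "T \<noteq> {}" for T
        using psubset.prems[of T] that by auto
    qed
    then obtain f where f: "\<forall>p\<in>S-{a}. f p < k"
      "\<forall>p\<in>S-{a}. \<forall>b\<in>S-{a}. R p b \<longrightarrow> f p \<noteq> (f b :: nat)"
      by blast
    have "card (f ` {b \<in> S. R a b}) < card {..<k}"
      using a(2) card_image_le[of "{b \<in> S. R a b}" f] psubset.hyps by simp
    then have "\<not> {..<k} \<subseteq> f ` {b \<in> S. R a b}"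
      using card_mono[of "f ` {b \<in> S. R a b}" "{..<k}"] psubset.hyps by auto
    then obtain m where m: "m < k" "m \<notin> f ` {b \<in> S. R a b}"
      by auto
    have "(\<forall>p\<in>S. (f(a := m)) p < k) \<and>
        (\<forall>p\<in>S. \<forall>b\<in>S. R p b \<longrightarrow> (f(a := m)) p \<noteq> (f(a := m)) b)"
      using f m irrefl sym by auto
    then show ?thesis by blast
  qed simp
qed

text \<open>An \<open>a\<close> outside \<open>B\<close> cannot collide with the choice from
  \<open>B\<close>, so only \<open>c\<close> has to avoid \<open>a\<close>, and then
  \<open>b\<close> has to avoid \<open>c\<close>.\<close>

lemma distinct_representatives_3:
  assumes "card A \<ge> 2" "card B \<ge> 2" "card C \<ge> 2" "\<not> A \<subseteq> B"
  obtains a b c where "a \<in> A" "b \<in> B" "c \<in> C" "a \<noteq> b" "a \<noteq> c" "b \<noteq> c"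
proof -
  have ex: "\<exists>z\<in>Z. z \<noteq> t" if "card Z \<ge> 2" for Z and t :: 'a
  proof (rule ccontr)
    assume "\<not> (\<exists>z\<in>Z. z \<noteq> t)"
    then have "Z \<subseteq> {t}" by auto
    then show False using card_mono[of "{t}" Z] that by simp
  qed
  obtain a where "a \<in> A" "a \<notin> B" using assms by blast
  moreover obtain c where "c \<in> C" "c \<noteq> a" using ex[of C] assms by blast
  moreover obtain b where "b \<in> B" "b \<noteq> c" using ex[of B] assms by blast
  ultimately show thesis using that by blast
qed

lemma cross_distinct_choices_3:
  assumes "card L = 3" and ge: "\<And>p. p \<in> L \<Longrightarrow> card (S p) \<ge> 2"
  shows "\<exists>x y. (\<forall>p\<in>L. x p \<in> S p \<and> y p \<in> S p) \<and> (\<forall>p\<in>L. \<forall>q\<in>L. p \<noteq> q \<longrightarrow> x p \<noteq> y q)"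
proof -
  obtain p q r where L: "L = {p, q, r}" and d: "p \<noteq> q" "p \<noteq> r" "q \<noteq> r"
    using assms(1) by (auto simp: card_3_iff)
  have ge2: "card (S p) \<ge> 2" "card (S q) \<ge> 2" "card (S r) \<ge> 2"
    using ge L by auto
  \<comment> \<open>If all three cyclic inclusions held, the lists would be equal; so for unequal
    lists one inclusion fails.\<close>
  consider "S p = S q" "S p = S r" | "\<not> S p \<subseteq> S q" | "\<not> S q \<subseteq> S r" | "\<not> S r \<subseteq> S p"
    by blast
  then show ?thesis
  proof cases
    case 1
    obtain T where "T \<subseteq> S p" "card T = 2"
      using obtain_subset_with_card_n[OF ge2(1)] by blast
    then obtain s t where "s \<in> S p" "t \<in> S p" "s \<noteq> t"
      by (auto simp: card_2_iff)
    then show ?thesis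
      using 1 L by (rule_tac x = "\<lambda>_. s" in exI, rule_tac x = "\<lambda>_. t" in exI) auto
  next
    case 2
    obtain a b c where z: "a \<in> S p" "b \<in> S q" "c \<in> S r" "a \<noteq> b" "a \<noteq> c" "b \<noteq> c"
      by (rule distinct_representatives_3[OF ge2(1) ge2(2) ge2(3) 2])
    let ?z = "(\<lambda>_. c)(p := a, q := b)"
    from z show ?thesis using L d
      by (rule_tac x = ?z in exI, rule_tac x = ?z in exI) auto
  next
    case 3
    obtain a b c where z: "b \<in> S q" "c \<in> S r" "a \<in> S p" "b \<noteq> c" "b \<noteq> a" "c \<noteq> a"
      by (rule distinct_representatives_3[OF ge2(2) ge2(3) ge2(1) 3])
    let ?z = "(\<lambda>_. c)(p := a, q := b)"
    from z show ?thesis using L d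
      by (rule_tac x = ?z in exI, rule_tac x = ?z in exI) auto
  next
    case 4
    obtain a b c where z: "c \<in> S r" "a \<in> S p" "b \<in> S q" "c \<noteq> a" "c \<noteq> b" "a \<noteq> b"
      by (rule distinct_representatives_3[OF ge2(3) ge2(1) ge2(2) 4])
    let ?z = "(\<lambda>_. c)(p := a, q := b)"
    from z show ?thesis using L d
      by (rule_tac x = ?z in exI, rule_tac x = ?z in exI) auto
  qed
qed

section \<open>Bipartite graphs as incidences of points in \<open>A\<close>, and counts of linked
  points\<close>

locale subcubic_incidence =
  fixes A :: "'a set" and I :: "'a \<Rightarrow> 'b \<Rightarrow> bool"
  assumes finite_A: "finite A"
    and finite_nbrs: "a \<in> A \<Longrightarrow> finite {b. I a b}"
    and card_nbrs: "a \<in> A \<Longrightarrow> card {b. I a b} \<le> 3"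
    and card_points: "card {a \<in> A. I a b} \<le> 3"
begin

definition linked :: "'a \<Rightarrow> 'a \<Rightarrow> bool" where
  "linked p q \<longleftrightarrow> p \<noteq> q \<and> (\<exists>b. I p b \<and> I q b)"

text \<open>The color of the edge \<open>pb\<close> is \<open>g p b\<close>. Every path with three
  edges reads \<open>b\<close>, \<open>p\<close>, \<open>m\<close>, \<open>q\<close> from one of its
  ends, with \<open>p\<close> and \<open>q\<close> in \<open>A\<close>, so one pattern covers all
  conflicts.\<close>

definition flag_coloring :: "'a set \<Rightarrow> ('a \<Rightarrow> 'b \<Rightarrow> nat) \<Rightarrow> bool" where
  "flag_coloring S g \<longleftrightarrow> (\<forall>p\<in>S. \<forall>b. I p b \<longrightarrow> g p b < 6) \<and>
     (\<forall>p\<in>S. \<forall>q\<in>S. \<forall>b m. p \<noteq> q \<longrightarrow> b \<noteq> m \<longrightarrow> I p b \<longrightarrow> I p m \<longrightarrow> I q m \<longrightarrow> g p b \<noteq> g q m)"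

lemma linked_sym: "linked p q \<Longrightarrow> linked q p"
  by (auto simp: linked_def)

lemma linked_irrefl: "\<not> linked p p"
  by (simp add: linked_def)

lemma card_other_points:
  assumes "p \<in> A" "I p b" "S \<subseteq> A"
  shows "card ({q \<in> S. I q b} - {p}) \<le> 2"
proof -
  have "card ({q \<in> S. I q b} - {p}) \<le> card ({q \<in> A. I q b} - {p})"
    using assms finite_A by (intro card_mono) auto
  also have "\<dots> = card {q \<in> A. I q b} - 1"
    using assms by (intro card_Diff_singleton) auto
  finally show ?thesis using card_points[of b] by simp
qed

text \<open>Besides \<open>b\<close> there are at most two neighbours, each with at most two points
  other than \<open>p\<close>.\<close>

lemma card_linked_avoiding:
  assumes "p \<in> A" "I p b" "S \<subseteq> A"
  shows "card (\<Union>m\<in>{m. I p m} - {b}. {q \<in> S. I q m} - {p}) \<le> 4"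
proof -
  have fin: "finite ({m. I p m} - {b})" using finite_nbrs assms by simp
  have "card (\<Union>m\<in>{m. I p m} - {b}. {q \<in> S. I q m} - {p})
      \<le> (\<Sum>m\<in>{m. I p m} - {b}. card ({q \<in> S. I q m} - {p}))"
    by (rule card_UN_le[OF fin])
  also have "\<dots> \<le> (\<Sum>m\<in>{m. I p m} - {b}. 2)"
    using assms card_other_points by (intro sum_mono) auto
  also have "\<dots> = 2 * (card {m. I p m} - 1)"
    using assms by (simp add: card_Diff_singleton)
  also have "\<dots> \<le> 4"
    using card_nbrs[of p] assms by simp
  finally show ?thesis .
qed

text \<open>Singling out \<open>b\<close> splits the bound six as 2 + 4: for \<open>p\<close> in
  \<open>A\<close>, two points through \<open>b\<close> and four through the other
  neighbours.\<close>

lemma linked_split: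
  assumes "I p b"
  shows "{q \<in> S. linked p q} =
    ({q \<in> S. I q b} - {p}) \<union> (\<Union>m\<in>{m. I p m} - {b}. {q \<in> S. I q m} - {p})"
  using assms by (auto simp: linked_def)

lemma card_linked_le:
  assumes "p \<in> A" "S \<subseteq> A"
  shows "card {q \<in> S. linked p q} \<le> 6"
proof (cases "\<exists>b. I p b")
  case True
  then obtain b where b: "I p b" ..
  show ?thesis
    unfolding linked_split[OF b]
    using card_Un_le[of "{q \<in> S. I q b} - {p}"
        "\<Union>m\<in>{m. I p m} - {b}. {q \<in> S. I q m} - {p}"]
      card_other_points[of p b S] card_linked_avoiding[of p b S] assms b
    by linarith
qed (simp add: linked_def)

section \<open>Sets whose points are each linked to six points of the set\<close>

context
  fixes U assumes UA: "U \<subseteq> A" and full: "p \<in> U \<Longrightarrow> 6 \<le> card {q \<in> U. linked p q}"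
begin

text \<open>The other neighbours of \<open>p\<close> supply at most four of the six linked points,
  so \<open>b\<close> must supply two besides \<open>p\<close>.\<close>

lemma card_points_full:
  assumes "p \<in> U" "I p b"
  shows "card {q \<in> U. I q b} = 3"
proof -
  have "6 \<le> card ({q \<in> U. I q b} - {p}) + 4"
    using full[OF assms(1), unfolded linked_split[OF assms(2)]]
      card_linked_avoiding[OF _ assms(2) UA] assms(1) UA
      card_Un_le[of "{q \<in> U. I q b} - {p}" "\<Union>m\<in>{m. I p m} - {b}. {q \<in> U. I q m} - {p}"]
    by fastforce
  moreover have "card ({q \<in> U. I q b} - {p}) = card {q \<in> U. I q b} - 1"
    using assms by (intro card_Diff_singleton) auto
  moreover have "card {q \<in> U. I q b} \<le> card {q \<in> A. I q b}"
    using UA finite_A by (intro card_mono) auto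
  ultimately show ?thesis using card_points[of b] by linarith
qed

text \<open>Otherwise \<open>q\<close> is reached through both \<open>b\<close> and
  \<open>m\<close>; counted only once, it leaves at most 1 + 4 points linked to
  \<open>p\<close>.\<close>

lemma no_4_cycle:
  assumes "p \<in> U" "q \<in> U" "p \<noteq> q" "I p b" "I q b" "I p m" "I q m"
  shows "b = m"
proof (rule ccontr)
  assume ne: "b \<noteq> m"
  let ?X = "\<Union>m\<in>{m. I p m} - {b}. {q \<in> U. I q m} - {p}"
  have "{q \<in> U. linked p q} = ({q \<in> U. I q b} - {p} - {q}) \<union> ?X"
    unfolding linked_split[OF assms(4)] using assms ne by auto
  then have "card {q \<in> U. linked p q} \<le> card ({q \<in> U. I q b} - {p} - {q}) + card ?X"
    by (simp only: card_Un_le)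
  moreover have "card ({q \<in> U. I q b} - {p} - {q}) = card ({q \<in> U. I q b} - {p}) - 1"
    using assms by (intro card_Diff_singleton) auto
  ultimately show False
    using full[OF assms(1)] card_other_points[of p b U] card_linked_avoiding[of p b U] assms UA
    by auto
qed

text \<open>The set \<open>U\<close> already contains six points linked to \<open>p\<close>, the
  most that \<open>A\<close> can have.\<close>

lemma linked_closed:
  assumes "p \<in> U" "q \<in> A" "linked p q"
  shows "q \<in> U"
proof -
  have "{q \<in> U. linked p q} = {q \<in> A. linked p q}"
    using UA finite_A full[OF assms(1)] card_linked_le[of p A] assms(1)
    by (intro card_seteq) auto
  then show ?thesis using assms by auto
qed

lemma flag_coloring_minimal_full:
  assumes "U \<noteq> {}"
    and minimal: "\<And>T. T \<subset> U \<Longrightarrow> T \<noteq> {} \<Longrightarrow> \<exists>a\<in>T. card {q \<in> T. linked a q} < 6"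
  shows "\<exists>g. flag_coloring U g"
proof -
  obtain p0 where p0: "p0 \<in> U" using assms by blast
  have "{q \<in> U. linked p0 q} \<noteq> {}" using full[OF p0] by force
  then obtain b where b: "I p0 b" by (auto simp: linked_def)
  define L where "L = {q \<in> U. I q b}"
  have L3: "card L = 3" using card_points_full[OF p0 b] by (simp add: L_def)
  have finU: "finite U" using UA finite_A finite_subset by blast
  \<comment> \<open>Since \<open>p0\<close> lies in \<open>L\<close>, every subset of
    \<open>U - L\<close> is proper in \<open>U\<close>, and minimality gives the degeneracy
    condition.\<close>
  have "\<exists>f. (\<forall>a\<in>U-L. f a < 6) \<and> (\<forall>a\<in>U-L. \<forall>b\<in>U-L. linked a b \<longrightarrow> f a \<noteq> (f b :: nat))"
  proof (rule degenerate_coloring[OF _ linked_sym linked_irrefl])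
    show "finite (U - L)" using finU by simp
    show "\<exists>a\<in>T. card {b \<in> T. linked a b} < 6" if "T \<subseteq> U - L" "T \<noteq> {}" for T
      using minimal[of T] that p0 b by (auto simp: L_def)
  qed
  then obtain f where f6: "\<And>a. a \<in> U-L \<Longrightarrow> f a < 6"
    and f: "\<And>p q. p \<in> U-L \<Longrightarrow> q \<in> U-L \<Longrightarrow> linked p q \<Longrightarrow> f p \<noteq> (f q :: nat)"
    by blast
  define S where "S p = {..<6} - f ` {q \<in> U - L. linked p q}" for p
  have "card (S p) \<ge> 2" if "p \<in> L" for p
  proof -
    have p: "p \<in> U" "I p b" using that by (auto simp: L_def)
    let ?X = "\<Union>m\<in>{m. I p m} - {b}. {q \<in> U. I q m} - {p}"
    \<comment> \<open>Points of \<open>U\<close> reached through \<open>b\<close> lie in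
      \<open>L\<close>, so only the other neighbours of \<open>p\<close> block colors: at most four
      of six.\<close>
    have "{q \<in> U - L. linked p q} \<subseteq> ?X"
      using p by (auto simp: L_def linked_def)
    then have "card {q \<in> U - L. linked p q} \<le> card ?X"
      using finU by (intro card_mono) (auto intro: finite_subset[of _ U])
    then have "card (f ` {q \<in> U - L. linked p q}) \<le> 4"
      using card_linked_avoiding[of p b U] p UA
        card_image_le[of "{q \<in> U - L. linked p q}" f] finU by auto
    moreover have "card {..<6::nat} - card (f ` {q \<in> U - L. linked p q}) \<le> card (S p)"
      unfolding S_def using finU by (intro diff_card_le_card_Diff) auto
    ultimately show ?thesis by simp
  qed
  then obtain x y where xy: "\<And>p. p \<in> L \<Longrightarrow> x p \<in> S p" "\<And>p. p \<in> L \<Longrightarrow> y p \<in> S p"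
    and ne: "\<And>p q. p \<in> L \<Longrightarrow> q \<in> L \<Longrightarrow> p \<noteq> q \<Longrightarrow> x p \<noteq> y q"
    using cross_distinct_choices_3[OF L3, of S] by blast
  define g where "g p m = (if p \<in> L then if m = b then x p else y p else f p)" for p m
  have gS: "g p m \<in> S p" if "p \<in> L" for p m
    using xy that by (simp add: g_def)
  have "g p m < 6" if "p \<in> U" for p m
  proof (cases "p \<in> L")
    case True
    then show ?thesis using gS[of p m] by (simp add: S_def)
  next
    case False
    then show ?thesis using f6[of p] that by (simp add: g_def)
  qed
  moreover have "g p n \<noteq> g q m"
    if "p \<in> U" "q \<in> U" "p \<noteq> q" "n \<noteq> m" "I p n" "I p m" "I q m" for p q n m
  proof -
    have l: "linked p q" using that by (auto simp: linked_def)
    consider "p \<notin> L" "q \<notin> L" | "p \<in> L" "q \<notin> L" | "p \<notin> L" "q \<in> L" | "p \<in> L" "q \<in> L"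
      by blast
    then show ?thesis
    proof cases
      case 1
      then show ?thesis using f[of p q] l that by (simp add: g_def)
    next
      case 2
      then have "g q m \<in> f ` {q \<in> U - L. linked p q}" using l that by (auto simp: g_def)
      then show ?thesis using gS[OF 2(1), of n] by (auto simp: S_def)
    next
      case 3
      then have "g p n \<in> f ` {p \<in> U - L. linked q p}"
        using linked_sym[OF l] that by (auto simp: g_def)
      then show ?thesis using gS[OF 3(2), of m] by (auto simp: S_def)
    next
      case 4
      \<comment> \<open>Both points are adjacent to \<open>b\<close>, so their common neighbour
        \<open>m\<close> is \<open>b\<close>; the colors compared are then \<open>y p\<close> and
        \<open>x q\<close>.\<close>
      then have "m = b"
        using no_4_cycle[of p q m b] that by (auto simp: L_def)
      then show ?thesis using 4 that ne[of q p] by (auto simp: g_def)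
    qed
  qed
  ultimately show ?thesis unfolding flag_coloring_def by blast
qed

end

section \<open>Coloring all points by splitting off minimal full sets\<close>

lemma flag_coloring_exists:
  assumes "S \<subseteq> A"
  shows "\<exists>g. flag_coloring S g"
proof -
  have "finite S" using assms finite_A finite_subset by blast
  then show ?thesis using assms
  proof (induction S rule: finite_psubset_induct)
    case (psubset S)
    define full where
      "full T \<longleftrightarrow> T \<subseteq> S \<and> T \<noteq> {} \<and> (\<forall>a\<in>T. 6 \<le> card {q \<in> T. linked a q})" for T
    show ?case
    proof (cases "\<exists>T. full T")
      case False
      then have "\<exists>f. (\<forall>a\<in>S. f a < 6) \<and> (\<forall>a\<in>S. \<forall>b\<in>S. linked a b \<longrightarrow> f a \<noteq> (f b :: nat))"
        using psubset.hyps
        by (intro degenerate_coloring[OF _ linked_sym linked_irrefl])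
          (auto simp: full_def not_le)
      then obtain f where f: "\<forall>a\<in>S. f a < 6"
        "\<forall>a\<in>S. \<forall>b\<in>S. linked a b \<longrightarrow> f a \<noteq> (f b :: nat)"
        by blast
      have "flag_coloring S (\<lambda>p _. f p)"
        using f by (auto simp: flag_coloring_def linked_def)
      then show ?thesis by blast
    next
      case True
      have "finite {T. full T}"
        using psubset.hyps by (auto simp: full_def intro: finite_subset[of _ "Pow S"])
      then obtain U where U: "full U" and min: "\<And>T. full T \<Longrightarrow> T \<subseteq> U \<Longrightarrow> T = U"
        using True finite_has_minimal[of "{T. full T}"] by auto
      have UA: "U \<subseteq> A" and fullU: "\<And>p. p \<in> U \<Longrightarrow> 6 \<le> card {q \<in> U. linked p q}"
        and "U \<noteq> {}" "U \<subseteq> S"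
        using U psubset.prems by (auto simp: full_def)
      have "\<exists>a\<in>T. card {q \<in> T. linked a q} < 6" if "T \<subset> U" "T \<noteq> {}" for T
        using min[of T] that \<open>U \<subseteq> S\<close> unfolding full_def not_le[symmetric] by blast
      then obtain g where g: "flag_coloring U g"
        using flag_coloring_minimal_full[OF UA fullU \<open>U \<noteq> {}\<close>] by blast
      \<comment> \<open>Induction colors the rest, which is smaller because \<open>U\<close> is
        nonempty; by \<open>linked_closed\<close> no conflict crosses between \<open>U\<close> and
        \<open>S - U\<close>.\<close>
      obtain h where h: "flag_coloring (S - U) h"
        using psubset.IH[of "S - U"] psubset.prems \<open>U \<noteq> {}\<close> \<open>U \<subseteq> S\<close> by auto
      define k where "k p = (if p \<in> U then g p else h p)" for p
      have "k p b < 6" if "p \<in> S" "I p b" for p b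
        using g h that by (auto simp: k_def flag_coloring_def)
      moreover have "k p b \<noteq> k q m"
        if "p \<in> S" "q \<in> S" "p \<noteq> q" "b \<noteq> m" "I p b" "I p m" "I q m" for p q b m
      proof -
        have "linked p q" using that by (auto simp: linked_def)
        then have "p \<in> U \<longleftrightarrow> q \<in> U"
          using linked_closed[OF UA fullU] linked_sym that psubset.prems by blast
        then show ?thesis
          using g h that by (auto simp: k_def flag_coloring_def)
      qed
      ultimately show ?thesis unfolding flag_coloring_def by blast
    qed
  qed
qed

end

section \<open>From incidences back to edges of the graph\<close>

lemma card_neighbours_le_degree:
  assumes "finite E"
  shows "finite {b. {a, b} \<in> E}" and "card {b. {a, b} \<in> E} \<le> degree E a"
proof -
  have inj: "inj_on (\<lambda>b. {a, b}) {b. {a, b} \<in> E}"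
    by (auto simp: inj_on_def doubleton_eq_iff)
  have sub: "(\<lambda>b. {a, b}) ` {b. {a, b} \<in> E} \<subseteq> {e \<in> E. a \<in> e}" by auto
  show "finite {b. {a, b} \<in> E}"
    using inj_on_finite[OF inj sub] assms by simp
  show "card {b. {a, b} \<in> E} \<le> degree E a"
    unfolding degree_def using inj sub assms by (intro card_inj_on_le) auto
qed

theorem theorem1p13:
  fixes V :: "'a set" and E :: "'a set set"
  assumes "finite_simple_graph V E"
    and "subcubic V E"
    and "bipartite V E"
  shows "injective_chromatic_index E \<le> 6"
proof -
  obtain X Y where XY: "X \<union> Y = V" "X \<inter> Y = {}"
    and edge: "\<forall>e\<in>E. \<exists>x\<in>X. \<exists>y\<in>Y. e = {x, y}"
    using assms(3) unfolding bipartite_def by (elim exE conjE)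
  have finV: "finite V" using assms(1) by (simp add: finite_simple_graph_def)
  have finE: "finite E"
    using assms(1) finite_subset[of E "Pow V"] by (auto simp: finite_simple_graph_def)
  have deg: "degree E v \<le> 3" if "v \<in> V" for v
    using assms(2) subcubic_iff[OF finV] that by blast
  define I where "I p b \<longleftrightarrow> p \<in> X \<and> b \<in> Y \<and> {p, b} \<in> E" for p b
  interpret subcubic_incidence X I
  proof
    show "finite X" using finV XY by auto
    show "finite {b. I a b}" if "a \<in> X" for a
      using card_neighbours_le_degree(1)[OF finE, of a]
      by (rule rev_finite_subset) (auto simp: I_def)
    show "card {b. I a b} \<le> 3" if "a \<in> X" for a
    proof -
      have "card {b. I a b} \<le> card {b. {a, b} \<in> E}"
        by (rule card_mono[OF card_neighbours_le_degree(1)[OF finE]]) (auto simp: I_def)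
      then show ?thesis
        using card_neighbours_le_degree(2)[OF finE, of a] deg[of a] that XY by auto
    qed
    \<comment> \<open>The bound concerns every \<open>b\<close> of the type; the degree serves for
      \<open>b\<close> in \<open>Y\<close>, and elsewhere there are no incidences.\<close>
    show "card {a \<in> X. I a b} \<le> 3" for b
    proof (cases "b \<in> Y")
      case True
      have "card {a \<in> X. I a b} \<le> card {a. {b, a} \<in> E}"
        by (rule card_mono[OF card_neighbours_le_degree(1)[OF finE]])
          (auto simp: I_def insert_commute)
      then show ?thesis
        using card_neighbours_le_degree(2)[OF finE, of b] deg[of b] True XY by auto
    qed (simp add: I_def)
  qed
  obtain g where g: "flag_coloring X g"
    using flag_coloring_exists[of X] by blast
  \<comment> \<open>An edge has exactly one end on each side, so both descriptions are well defined;
    \<open>Suc\<close> shifts the colors 0 to 5 to 1 to 6.\<close>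
  define c where "c e = Suc (g (THE p. p \<in> X \<inter> e) (THE b. b \<in> Y \<inter> e))" for e
  have c: "c {p, b} = Suc (g p b)" if "p \<in> X" "b \<in> Y" for p b
  proof -
    have "X \<inter> {p, b} = {p}" "Y \<inter> {p, b} = {b}" using that XY by auto
    then show ?thesis by (simp add: c_def)
  qed
  have "c e \<in> {1..6}" if e: "e \<in> E" for e
  proof -
    obtain p b where pb: "p \<in> X" "b \<in> Y" "e = {p, b}" using edge e by blast
    then have "g p b < 6" using g e by (auto simp: flag_coloring_def I_def)
    then show ?thesis using c pb by simp
  qed
  moreover have "c e1 \<noteq> c e3" if "consecutive E e1 e2 e3" for e1 e2 e3
  proof -
    have mem: "e1 \<in> E" "e2 \<in> E" "e3 \<in> E" using that by (auto simp: consecutive_def)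
    have side: "u \<in> X \<and> v \<in> Y \<or> u \<in> Y \<and> v \<in> X" if "{u, v} \<in> E" for u v
      using bspec[OF edge that] by (auto simp: doubleton_eq_iff)
    have ne: "c {p, b} \<noteq> c {m, q}"
      if "{p, b} \<in> E" "{p, m} \<in> E" "{q, m} \<in> E" "p \<in> X" "b \<in> Y" "m \<in> Y" "q \<in> X"
        "p \<noteq> q" "b \<noteq> m" for p b m q
    proof -
      have "g p b \<noteq> g q m"
        using g that by (auto simp: flag_coloring_def I_def)
      then show ?thesis using c[of p b] c[of q m] that by (simp add: insert_commute[of m q])
    qed
    from that consider
        (path) w x y z where "distinct [w, x, y, z]" "e1 = {w, x}" "e2 = {x, y}" "e3 = {y, z}"
      | (triangle) x y z where "e1 = {x, y}" "e2 = {y, z}" "e3 = {z, x}"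
      unfolding consecutive_def by blast
    then show ?thesis
    proof cases
      case path
      show ?thesis
      proof (cases "x \<in> X")
        case True
        then have "w \<in> Y" "y \<in> Y" "z \<in> X"
          using side mem path XY by blast+
        then show ?thesis
          using ne[of x w y z] mem path True by (auto simp: insert_commute)
      next
        case False
        \<comment> \<open>Read backwards from \<open>z\<close>, the path has its second vertex
          \<open>y\<close> in \<open>X\<close>.\<close>
        then have "x \<in> Y" "w \<in> X" "y \<in> X" "z \<in> Y"
          using side mem path XY by blast+
        then show ?thesis
          using ne[of y z x w] mem path by (auto simp: insert_commute)
      qed
    next
      case triangle
      \<comment> \<open>A triangle cannot alternate between two sides.\<close>
      then show ?thesis using side mem XY by blast
    qed
  qed
  ultimately have "injective_edge_coloring E 6 c"
    unfolding injective_edge_coloring_def by blast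
  then show ?thesis
    unfolding injective_chromatic_index_def by (intro Least_le exI)
qed

end
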